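(* Let $\mathsf{V}_1$ be the pseudovariety of all finite semigroups $S$ such that $(exf)^{\omega+1}=exf$ for all $x\in S$ and all idempotents $e,f\in S$. Then $\mathsf{V}_1$ is saturated, and hence epimorphically closed.
   Context: For an element $s$ of a finite semigroup, $s^\omega$ denotes its unique idempotent power, and $s^{\omega+1}=s^\omega s$. A homomorphism of semigroups $\alpha:S\to T$ is an epimorphism if, for all semigroups $R$ and homomorphisms $\beta,\gamma:T\to R$, $\beta\circ\alpha=\gamma\circ\alpha$ implies $\beta=\gamma$. For a subsemigroup $U$ of a semigroup $S$, the dominion $\mathrm{Dom}(U,S)$ is the set of all $d\in S$ such that, for every semigroup $T$, any two homomorphisms $S\to T$ that agree on $U$ also agree at $d$. A semigroup $U$ is saturated if $\mathrm{Dom}(U,S)\ne S$ for every semigroup $S$ (not necessarily finite) properly containing $U$ as a subsemigroup. A class $\mathcal{C}$ of semigroups is saturated if each of its members is saturated; it is epimorphically closed if, whenever $S\in\mathcal{C}$ and $\alpha:S\to T$ is an epimorphism of semigroups, $T\in\mathcal{C}$. *)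

theory Defs
  imports "HOL-Algebra.Congruence"
begin

text \<open>
  HOL-Algebra has no carrier-based semigroups without a unit, so we extend its
  \<open>partial_object\<close> by a bare multiplication. Nothing is assumed about the multiplication
  outside the carrier. The empty semigroup is admitted.
\<close>

record 'a magma = "'a partial_object" +
  mul :: "'a \<Rightarrow> 'a \<Rightarrow> 'a"  (infixl "\<cdot>\<index>" 70)

definition is_semigroup :: "'a magma \<Rightarrow> bool" where
  "is_semigroup S \<longleftrightarrow>
     (\<forall>x\<in>carrier S. \<forall>y\<in>carrier S. x \<cdot>\<^bsub>S\<^esub> y \<in> carrier S) \<and>
     (\<forall>x\<in>carrier S. \<forall>y\<in>carrier S. \<forall>z\<in>carrier S.
        (x \<cdot>\<^bsub>S\<^esub> y) \<cdot>\<^bsub>S\<^esub> z = x \<cdot>\<^bsub>S\<^esub> (y \<cdot>\<^bsub>S\<^esub> z))"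

definition sg_hom :: "'a magma \<Rightarrow> 'b magma \<Rightarrow> ('a \<Rightarrow> 'b) set" where
  "sg_hom S T = {h. (\<forall>x\<in>carrier S. h x \<in> carrier T) \<and>
     (\<forall>x\<in>carrier S. \<forall>y\<in>carrier S. h (x \<cdot>\<^bsub>S\<^esub> y) = h x \<cdot>\<^bsub>T\<^esub> h y)}"

definition idempotents :: "'a magma \<Rightarrow> 'a set" where
  "idempotents S = {e \<in> carrier S. e \<cdot>\<^bsub>S\<^esub> e = e}"

text \<open>Only positive exponents are meaningful; \<open>spow S s 0\<close> is the junk value \<open>s\<close>.\<close>

definition spow :: "'a magma \<Rightarrow> 'a \<Rightarrow> nat \<Rightarrow> 'a" where
  "spow S s n = ((\<lambda>t. t \<cdot>\<^bsub>S\<^esub> s) ^^ (n - 1)) s"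

definition omega :: "'a magma \<Rightarrow> 'a \<Rightarrow> 'a" where
  "omega S s = (THE e. e \<in> idempotents S \<and> (\<exists>n\<ge>1. e = spow S s n))"

definition omega_plus_one :: "'a magma \<Rightarrow> 'a \<Rightarrow> 'a" where
  "omega_plus_one S s = omega S s \<cdot>\<^bsub>S\<^esub> s"

definition V1 :: "'a magma set" where
  "V1 = {S. is_semigroup S \<and> finite (carrier S) \<and>
     (\<forall>x\<in>carrier S. \<forall>e\<in>idempotents S. \<forall>f\<in>idempotents S.
        omega_plus_one S (e \<cdot>\<^bsub>S\<^esub> x \<cdot>\<^bsub>S\<^esub> f) = e \<cdot>\<^bsub>S\<^esub> x \<cdot>\<^bsub>S\<^esub> f)}"

text \<open>
  Dominions and epimorphisms quantify over homomorphisms from \<open>S\<close> into arbitrary semigroups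
  \<open>T\<close>, and a HOL formula cannot quantify over the type of the elements of \<open>T\<close>.
  Two homomorphisms from \<open>S\<close> into \<open>T\<close> both take values in the subsemigroup generated by
  their images, which is a quotient of the free semigroup on two copies of the carrier of
  \<open>S\<close>; it can be realised as a set of congruence classes of words. It therefore suffices
  to let \<open>T\<close> range over the semigroups whose elements are sets of words. That no generality
  is lost is proved below, in \<open>dominion_all_types\<close> and
  \<open>epimorphism_all_types\<close>.
\<close>

type_synonym 'a word_classes = "('a + 'a) list set"

definition dominion :: "'a set \<Rightarrow> 'a magma \<Rightarrow> 'a set" where
  "dominion U S = {d \<in> carrier S.
     \<forall>T :: 'a word_classes magma. is_semigroup T \<longrightarrow>
       (\<forall>\<beta>\<in>sg_hom S T. \<forall>\<gamma>\<in>sg_hom S T. (\<forall>u\<in>U. \<beta> u = \<gamma> u) \<longrightarrow> \<beta> d = \<gamma> d)}"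

definition epimorphism :: "'a magma \<Rightarrow> 'b magma \<Rightarrow> ('a \<Rightarrow> 'b) \<Rightarrow> bool" where
  "epimorphism S T \<alpha> \<longleftrightarrow> \<alpha> \<in> sg_hom S T \<and>
     (\<forall>R :: 'b word_classes magma. is_semigroup R \<longrightarrow>
       (\<forall>\<beta>\<in>sg_hom T R. \<forall>\<gamma>\<in>sg_hom T R.
          (\<forall>s\<in>carrier S. \<beta> (\<alpha> s) = \<gamma> (\<alpha> s)) \<longrightarrow> (\<forall>t\<in>carrier T. \<beta> t = \<gamma> t)))"

text \<open>
  The semigroups \<open>S\<close> containing \<open>U\<close> range over all semigroups with elements in the type
  \<open>'b\<close>, which is unrelated to the element type of \<open>U\<close> (which might be finite); so
  containment is expressed by an embedding \<open>\<iota>\<close>. Literal containment is the case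
  \<open>\<iota> = (\<lambda>x. x)\<close>, see \<open>saturated_subsemigroup\<close>. A theorem in which \<open>'b\<close> is a free
  type variable speaks about all semigroups \<open>S\<close>.
\<close>

definition saturated :: "'b itself \<Rightarrow> 'a magma \<Rightarrow> bool" where
  "saturated _ U \<longleftrightarrow> (\<forall>(S :: 'b magma) \<iota>.
     is_semigroup S \<and> \<iota> \<in> sg_hom U S \<and> inj_on \<iota> (carrier U) \<and> \<iota> ` carrier U \<noteq> carrier S
       \<longrightarrow> dominion (\<iota> ` carrier U) S \<noteq> carrier S)"

definition saturated_class :: "'b itself \<Rightarrow> 'a magma set \<Rightarrow> bool" where
  "saturated_class b C \<longleftrightarrow> (\<forall>U\<in>C. saturated b U)"

text \<open>
  A class of semigroups, such as \<open>V1\<close>, has one instance for each element type; the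
  arguments \<open>C\<close> and \<open>D\<close> are the instances of the same class at the element types
  of the domain and of the codomain.
\<close>

definition epimorphically_closed :: "'a magma set \<Rightarrow> 'b magma set \<Rightarrow> bool" where
  "epimorphically_closed C D \<longleftrightarrow>
     (\<forall>S\<in>C. \<forall>T \<alpha>. is_semigroup T \<and> epimorphism S T \<alpha> \<longrightarrow> T \<in> D)"


subsection \<open>The idempotent power is well defined\<close>

lemma spow_Suc: "n \<ge> 1 \<Longrightarrow> spow S s (Suc n) = spow S s n \<cdot>\<^bsub>S\<^esub> s"
  by (cases n) (simp_all add: spow_def)

lemma spow_1: "spow S s (Suc 0) = s"
  by (simp add: spow_def)

lemma spow_closed:
  assumes "is_semigroup S" "s \<in> carrier S"
  shows "spow S s n \<in> carrier S"
proof -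
  have "((\<lambda>t. t \<cdot>\<^bsub>S\<^esub> s) ^^ k) s \<in> carrier S" for k
    using assms by (induction k) (auto simp: is_semigroup_def)
  then show ?thesis by (simp add: spow_def)
qed

lemma spow_add:
  assumes S: "is_semigroup S" "s \<in> carrier S" and "m \<ge> 1" "n \<ge> 1"
  shows "spow S s (m + n) = spow S s m \<cdot>\<^bsub>S\<^esub> spow S s n"
  using \<open>n \<ge> 1\<close>
proof (induction n rule: dec_induct)
  case base
  show ?case using \<open>m \<ge> 1\<close> by (simp add: spow_Suc spow_1)
next
  case (step n)
  have "spow S s (m + Suc n) = (spow S s m \<cdot>\<^bsub>S\<^esub> spow S s n) \<cdot>\<^bsub>S\<^esub> s"
    using step \<open>m \<ge> 1\<close> by (simp add: spow_Suc)
  also have "\<dots> = spow S s m \<cdot>\<^bsub>S\<^esub> (spow S s n \<cdot>\<^bsub>S\<^esub> s)"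
    using S spow_closed[OF S] unfolding is_semigroup_def by blast
  finally show ?case using step by (simp add: spow_Suc)
qed

lemma spow_idem_mult:
  assumes S: "is_semigroup S" "s \<in> carrier S" and "m \<ge> 1"
    and idem: "spow S s m \<in> idempotents S" and "k \<ge> 1"
  shows "spow S s (m * k) = spow S s m"
  using \<open>k \<ge> 1\<close>
proof (induction k rule: dec_induct)
  case base
  show ?case by simp
next
  case (step k)
  have "spow S s (m * k + m) = spow S s (m * k) \<cdot>\<^bsub>S\<^esub> spow S s m"
    by (rule spow_add[OF S]) (use step \<open>m \<ge> 1\<close> in auto)
  then show ?case using step idem by (simp add: idempotents_def add.commute)
qed

lemma ex1_idempotent_power:
  assumes S: "is_semigroup S" "s \<in> carrier S" and fin: "finite (carrier S)"
  shows "\<exists>!e. e \<in> idempotents S \<and> (\<exists>n\<ge>1. e = spow S s n)"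
proof (rule ex_ex1I)
  have "\<not> inj_on (spow S s) {1..}"
  proof
    assume "inj_on (spow S s) {1..}"
    moreover have "finite (spow S s ` {1..})"
      using fin by (rule rev_finite_subset) (use spow_closed[OF S] in auto)
    ultimately show False
      using finite_imageD infinite_Ici by blast
  qed
  then obtain a b where ab: "a \<ge> 1" "a < b" "spow S s a = spow S s b"
    unfolding inj_on_def by (metis atLeast_iff linorder_neqE_nat)
  define p where "p = b - a"
  have p: "p \<ge> 1" "spow S s (a + p) = spow S s a"
    using ab by (auto simp: p_def)
  have step: "spow S s (n + p) = spow S s n" if "n \<ge> a" for n
  proof (cases "n = a")
    case True
    then show ?thesis using p by simp
  next
    case False
    then have l: "n - a \<ge> 1" using that by simp
    have "spow S s (n + p) = spow S s ((a + p) + (n - a))" using that by (simp add: add.commute)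
    also have "\<dots> = spow S s a \<cdot>\<^bsub>S\<^esub> spow S s (n - a)"
      using l p ab(1) by (subst spow_add[OF S]) auto
    also have "\<dots> = spow S s (a + (n - a))"
      using l ab(1) by (subst spow_add[OF S]) auto
    finally show ?thesis using that by simp
  qed
  have steps: "spow S s (n + k * p) = spow S s n" if "n \<ge> a" for n k
  proof (induction k)
    case (Suc k)
    have "spow S s (n + Suc k * p) = spow S s ((n + k * p) + p)" by (simp add: algebra_simps)
    then show ?case using step[of "n + k * p"] Suc that by simp
  qed simp
  have ap: "a * p \<ge> a" "a * p \<ge> 1" using p ab(1) by auto
  have "spow S s (a * p) \<cdot>\<^bsub>S\<^esub> spow S s (a * p) = spow S s (a * p + a * p)"
    using ap by (intro spow_add[OF S, symmetric])
  also have "\<dots> = spow S s (a * p)" using steps[OF ap(1)] by simp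
  finally have "spow S s (a * p) \<in> idempotents S"
    using spow_closed[OF S] by (simp add: idempotents_def)
  then show "\<exists>e. e \<in> idempotents S \<and> (\<exists>n\<ge>1. e = spow S s n)" using ap by blast
next
  fix e f
  assume "e \<in> idempotents S \<and> (\<exists>n\<ge>1. e = spow S s n)"
    and "f \<in> idempotents S \<and> (\<exists>n\<ge>1. f = spow S s n)"
  then obtain m n where e: "e \<in> idempotents S" "m \<ge> 1" "e = spow S s m"
    and f: "f \<in> idempotents S" "n \<ge> 1" "f = spow S s n" by blast
  have "spow S s (m * n) = e" using e f spow_idem_mult[OF S] by blast
  moreover have "spow S s (n * m) = f" using e f spow_idem_mult[OF S] by blast
  ultimately show "e = f" by (simp add: mult.commute)
qed


subsection \<open>Independence of the type of the codomains\<close>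

lemma dominion_all_types:
  fixes S :: "'a magma" and T :: "'c magma"
  assumes d: "d \<in> dominion U S" and U: "U \<subseteq> carrier S" and T: "is_semigroup T"
    and \<beta>: "\<beta> \<in> sg_hom S T" and \<gamma>: "\<gamma> \<in> sg_hom S T"
    and agree: "\<And>u. u \<in> U \<Longrightarrow> \<beta> u = \<gamma> u"
  shows "\<beta> d = \<gamma> d"
proof -
  define g where "g = case_sum \<beta> \<gamma>"
  define ev where "ev w = foldl (\<lambda>t x. t \<cdot>\<^bsub>T\<^esub> g x) (g (hd w)) (tl w)" for w
  define W where "W = {w. w \<noteq> [] \<and> set w \<subseteq> carrier S <+> carrier S}"
  define P where "P = ev ` W"
  define \<phi> where "\<phi> t = {w \<in> W. ev w = t}" for t
  have g_in: "g x \<in> carrier T" if "x \<in> carrier S <+> carrier S" for x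
    using that \<beta> \<gamma> by (auto simp: g_def sg_hom_def)
  have fold_in: "foldl (\<lambda>t x. t \<cdot>\<^bsub>T\<^esub> g x) t w \<in> carrier T"
    if "t \<in> carrier T" "set w \<subseteq> carrier S <+> carrier S" for t w
    using that
  proof (induction w arbitrary: t)
    case (Cons x w)
    then have "t \<cdot>\<^bsub>T\<^esub> g x \<in> carrier T" using T g_in by (simp add: is_semigroup_def)
    then show ?case using Cons by simp
  qed simp
  have fold_mul: "foldl (\<lambda>t x. t \<cdot>\<^bsub>T\<^esub> g x) (r \<cdot>\<^bsub>T\<^esub> t) w = r \<cdot>\<^bsub>T\<^esub> foldl (\<lambda>t x. t \<cdot>\<^bsub>T\<^esub> g x) t w"
    if "r \<in> carrier T" "t \<in> carrier T" "set w \<subseteq> carrier S <+> carrier S" for r t w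
    using that
  proof (induction w arbitrary: t)
    case (Cons x w)
    then have gx: "g x \<in> carrier T" using g_in by simp
    then have "t \<cdot>\<^bsub>T\<^esub> g x \<in> carrier T" using T Cons by (simp add: is_semigroup_def)
    moreover have "(r \<cdot>\<^bsub>T\<^esub> t) \<cdot>\<^bsub>T\<^esub> g x = r \<cdot>\<^bsub>T\<^esub> (t \<cdot>\<^bsub>T\<^esub> g x)"
      using T gx Cons by (simp add: is_semigroup_def)
    ultimately show ?case using Cons by simp
  qed simp
  have ev_in: "ev w \<in> carrier T" if "w \<in> W" for w
    using that g_in fold_in by (cases w) (auto simp: ev_def W_def)
  have ev_append: "ev (v @ w) = ev v \<cdot>\<^bsub>T\<^esub> ev w" if "v \<in> W" "w \<in> W" for v w
  proof -
    obtain x w' where w: "w = x # w'" using \<open>w \<in> W\<close> by (cases w) (auto simp: W_def)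
    have "ev (v @ w) = foldl (\<lambda>t x. t \<cdot>\<^bsub>T\<^esub> g x) (ev v \<cdot>\<^bsub>T\<^esub> g x) w'"
      using \<open>v \<in> W\<close> by (simp add: ev_def W_def w)
    also have "\<dots> = ev v \<cdot>\<^bsub>T\<^esub> ev w"
      using fold_mul[of "ev v" "g x" w'] ev_in[OF \<open>v \<in> W\<close>] g_in[of x] \<open>w \<in> W\<close>
      by (simp add: ev_def w W_def)
    finally show ?thesis .
  qed
  have P_mul: "s \<cdot>\<^bsub>T\<^esub> t \<in> P" if "s \<in> P" "t \<in> P" for s t
  proof -
    obtain v w where "v \<in> W" "w \<in> W" "s = ev v" "t = ev w" using \<open>s \<in> P\<close> \<open>t \<in> P\<close>
      by (auto simp: P_def)
    moreover from this have "v @ w \<in> W" by (auto simp: W_def)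
    ultimately show ?thesis using ev_append by (metis P_def image_eqI)
  qed
  have P_sub: "P \<subseteq> carrier T" using ev_in by (auto simp: P_def)
  have \<phi>_inj: "inj_on \<phi> P"
  proof (rule inj_onI)
    fix s t assume "s \<in> P" "t \<in> P" "\<phi> s = \<phi> t"
    from \<open>s \<in> P\<close> obtain w where "w \<in> W" "ev w = s" by (auto simp: P_def)
    then have "w \<in> \<phi> t" using \<open>\<phi> s = \<phi> t\<close> by (auto simp: \<phi>_def)
    then show "s = t" using \<open>ev w = s\<close> by (simp add: \<phi>_def)
  qed
  have \<beta>P: "\<beta> x \<in> P" and \<gamma>P: "\<gamma> x \<in> P" if "x \<in> carrier S" for x
  proof -
    have "[Inl x] \<in> W" "ev [Inl x] = \<beta> x" "[Inr x] \<in> W" "ev [Inr x] = \<gamma> x"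
      using that by (auto simp: W_def ev_def g_def)
    then show "\<beta> x \<in> P" "\<gamma> x \<in> P" by (metis P_def image_eqI)+
  qed
  define \<psi> where "\<psi> = inv_into P \<phi>"
  have \<psi>\<phi>: "\<psi> (\<phi> t) = t" if "t \<in> P" for t
    using that \<phi>_inj by (simp add: \<psi>_def)
  define R :: "'a word_classes magma" where
    "R = \<lparr>carrier = \<phi> ` P, mul = (\<lambda>a b. \<phi> (\<psi> a \<cdot>\<^bsub>T\<^esub> \<psi> b))\<rparr>"
  have R: "is_semigroup R"
    unfolding is_semigroup_def
  proof (intro conjI ballI)
    fix a b assume "a \<in> carrier R" "b \<in> carrier R"
    then show "a \<cdot>\<^bsub>R\<^esub> b \<in> carrier R" using P_mul \<psi>\<phi> by (auto simp: R_def)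
  next
    fix a b c assume "a \<in> carrier R" "b \<in> carrier R" "c \<in> carrier R"
    then obtain r s t where rst: "r \<in> P" "s \<in> P" "t \<in> P"
      and abc: "a = \<phi> r" "b = \<phi> s" "c = \<phi> t"
      by (auto simp: R_def)
    have "(r \<cdot>\<^bsub>T\<^esub> s) \<cdot>\<^bsub>T\<^esub> t = r \<cdot>\<^bsub>T\<^esub> (s \<cdot>\<^bsub>T\<^esub> t)"
      using T rst P_sub unfolding is_semigroup_def by blast
    then show "(a \<cdot>\<^bsub>R\<^esub> b) \<cdot>\<^bsub>R\<^esub> c = a \<cdot>\<^bsub>R\<^esub> (b \<cdot>\<^bsub>R\<^esub> c)"
      using rst P_mul by (simp add: abc R_def \<psi>\<phi>)
  qed
  have hom: "(\<lambda>x. \<phi> (\<delta> x)) \<in> sg_hom S R"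
    if "\<delta> \<in> sg_hom S T" "\<And>x. x \<in> carrier S \<Longrightarrow> \<delta> x \<in> P" for \<delta>
    using that by (simp add: sg_hom_def R_def \<psi>\<phi>)
  have "\<phi> (\<beta> d) = \<phi> (\<gamma> d)"
  proof -
    have "(\<forall>u\<in>U. b u = c u) \<longrightarrow> b d = c d" if "b \<in> sg_hom S R" "c \<in> sg_hom S R" for b c
      using d R that by (simp add: dominion_def)
    from this[OF hom[OF \<beta> \<beta>P] hom[OF \<gamma> \<gamma>P]] show ?thesis using agree by simp
  qed
  moreover have "d \<in> carrier S" using d by (simp add: dominion_def)
  ultimately show ?thesis using \<phi>_inj \<beta>P \<gamma>P by (meson inj_onD)
qed

lemma epimorphism_iff_dominion:
  "epimorphism S T \<alpha> \<longleftrightarrow> \<alpha> \<in> sg_hom S T \<and> dominion (\<alpha> ` carrier S) T = carrier T"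
  unfolding epimorphism_def dominion_def by blast

lemma epimorphism_all_types:
  fixes R :: "'c magma"
  assumes "epimorphism S T \<alpha>" "is_semigroup R" "\<beta> \<in> sg_hom T R" "\<gamma> \<in> sg_hom T R"
    and "\<And>s. s \<in> carrier S \<Longrightarrow> \<beta> (\<alpha> s) = \<gamma> (\<alpha> s)" and "t \<in> carrier T"
  shows "\<beta> t = \<gamma> t"
proof -
  have "t \<in> dominion (\<alpha> ` carrier S) T"
    using assms by (simp add: epimorphism_iff_dominion)
  moreover have "\<alpha> ` carrier S \<subseteq> carrier T"
    using assms(1) by (auto simp: epimorphism_def sg_hom_def)
  moreover have "\<And>u. u \<in> \<alpha> ` carrier S \<Longrightarrow> \<beta> u = \<gamma> u" using assms(5) by auto
  ultimately show ?thesis by (metis dominion_all_types[OF _ _ assms(2-4)])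
qed

lemma saturated_subsemigroup:
  fixes U S :: "'a magma"
  assumes "saturated TYPE('a) U" "is_semigroup S" "carrier U \<subset> carrier S"
    and "\<And>x y. x \<in> carrier U \<Longrightarrow> y \<in> carrier U \<Longrightarrow> x \<cdot>\<^bsub>U\<^esub> y = x \<cdot>\<^bsub>S\<^esub> y"
  shows "dominion (carrier U) S \<noteq> carrier S"
proof -
  have "(\<lambda>x. x) \<in> sg_hom U S" using assms(3,4) by (auto simp: sg_hom_def)
  then show ?thesis
    using assms(1)[unfolded saturated_def, rule_format, of S "\<lambda>x. x"] assms(2,3) by auto
qed

end

theory Submission
  imports Defs
begin

text \<open>
  Let \<open>U\<close> be a finite subsemigroup of \<open>S\<close> with dominion \<open>S \<noteq> U\<close>. Every predicate \<open>f\<close> on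
  \<open>S\<^sup>1 \<times> S\<^sup>1\<close> with \<open>f (xu) y = f x (uy)\<close> for \<open>u \<in> U\<close> then satisfies \<open>f d 1 = f 1 d\<close> for all
  \<open>d \<in> S\<close>; this is the part of Isbell's zigzag theorem that is needed. Applied to
  \<open>f x y \<longleftrightarrow> ex \<in> U\<^sup>1 \<and> xy = d\<close>, where \<open>d \<notin> U\<close> and \<open>ed = d\<close>, it yields \<open>x = ex \<notin> U\<close> and
  \<open>u \<in> U\<close> with \<open>xu \<in> U\<close> and \<open>d \<in> xuS\<close>. If \<open>e\<close> is an idempotent with \<open>eU\<close> minimal subject to
  \<open>ed = d\<close>, the identity of \<open>V1\<close> forces \<open>e \<in> xU\<close>. After moving \<open>x\<close> within \<open>S - U\<close> it is fixed
  on the right by an idempotent \<open>k\<close>, and \<open>UeU \<subset> UkU\<close>, since equality would put \<open>x = xk\<close> into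
  \<open>eU\<close>. The dual step applies to \<open>x\<close> and \<open>k\<close>, so the principal ideals of \<open>U\<close> would ascend for ever.
\<close>


subsection \<open>Balanced predicates\<close>

text \<open>
  The elements outside the carrier multiply so that the operation is associative on the whole type:
  a product is its leftmost factor outside the carrier, if there is one.
\<close>

fun mul1 :: "'a magma \<Rightarrow> 'a option \<Rightarrow> 'a option \<Rightarrow> 'a option" where
  "mul1 S None y = y"
| "mul1 S x None = x"
| "mul1 S (Some a) (Some b) =
     Some (if a \<notin> carrier S then a else if b \<notin> carrier S then b else a \<cdot>\<^bsub>S\<^esub> b)"

lemma mul1_None_right [simp]: "mul1 S x None = x"
  by (cases x) auto

lemma monoid_mul1:
  assumes "is_semigroup S"
  shows "monoid (mul1 S) None"
proof
  fix x y z
  show "mul1 S (mul1 S x y) z = mul1 S x (mul1 S y z)"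
    using assms by (cases x; cases y; cases z) (auto simp: is_semigroup_def)
qed auto

text \<open>
  Let \<open>S\<close> act on pairs \<open>(g, t)\<close>, where \<open>t \<in> S\<^sup>1\<close> and \<open>g\<close> is a predicate on \<open>S\<^sup>1\<close>, and let \<open>P\<close> be the
  involution adding \<open>f t\<close> to \<open>g\<close> modulo 2. Balancedness of \<open>f\<close> says that \<open>P\<close> commutes with the action
  of \<open>U\<close>; so the action and its conjugate by \<open>P\<close> agree on \<open>U\<close>, hence on the dominion of \<open>U\<close>.
\<close>

lemma dominion_balanced:
  fixes S :: "'a magma" and f :: "'a option \<Rightarrow> 'a option \<Rightarrow> bool"
  defines "S1 \<equiv> insert None (Some ` carrier S)"
  assumes S: "is_semigroup S" and U: "U \<subseteq> carrier S" and d: "d \<in> dominion U S"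
    and bal: "\<And>x y u. x \<in> S1 \<Longrightarrow> y \<in> S1 \<Longrightarrow> u \<in> U \<Longrightarrow>
      f (mul1 S x (Some u)) y \<longleftrightarrow> f x (mul1 S (Some u) y)"
  shows "f (Some d) None \<longleftrightarrow> f None (Some d)"
proof -
  interpret monoid "mul1 S" None by (rule monoid_mul1[OF S])
  \<comment> \<open>Restricts \<open>f\<close> to \<open>S1\<close>: balancedness is assumed only
    there, whereas the maps below act on the whole type.\<close>
  define F where "F x y \<longleftrightarrow> x \<in> S1 \<and> y \<in> S1 \<and> f x y" for x y
  define P where "P p = (\<lambda>a. fst p a \<noteq> F (snd p) a, snd p)"
    for p :: "('a option \<Rightarrow> bool) \<times> 'a option"
  define \<beta> where "\<beta> s p = (\<lambda>a. fst p (mul1 S (Some s) a), mul1 S (snd p) (Some s))"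
    for s and p :: "('a option \<Rightarrow> bool) \<times> 'a option"
  define \<gamma> where "\<gamma> s = P \<circ> \<beta> s \<circ> P" for s
  \<comment> \<open>The action is from the right, so composition is reversed to make
    \<open>\<beta>\<close> a homomorphism.\<close>
  let ?T = "\<lparr>carrier = UNIV, mul = (\<lambda>p q. q \<circ> p)\<rparr> ::
    (('a option \<Rightarrow> bool) \<times> 'a option \<Rightarrow> ('a option \<Rightarrow> bool) \<times> 'a option) magma"
  have PP: "P (P p) = p" for p by (auto simp: P_def prod_eq_iff)
  have T: "is_semigroup ?T" by (auto simp: is_semigroup_def)
  have \<beta>_mult: "\<beta> (x \<cdot>\<^bsub>S\<^esub> y) = \<beta> y \<circ> \<beta> x" if "x \<in> carrier S" "y \<in> carrier S" for x y
  proof -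
    have "Some (x \<cdot>\<^bsub>S\<^esub> y) = mul1 S (Some x) (Some y)" using that by simp
    then show ?thesis by (auto simp: \<beta>_def assoc fun_eq_iff simp del: mul1.simps(3))
  qed
  have \<beta>: "\<beta> \<in> sg_hom S ?T" by (simp add: sg_hom_def \<beta>_mult)
  have \<gamma>: "\<gamma> \<in> sg_hom S ?T" by (auto simp: sg_hom_def \<beta>_mult \<gamma>_def PP fun_eq_iff)
  have S1r: "mul1 S x (Some u) \<in> S1 \<longleftrightarrow> x \<in> S1" and S1l: "mul1 S (Some u) x \<in> S1 \<longleftrightarrow> x \<in> S1"
    if "u \<in> carrier S" for u x
    using that S by (cases x; auto simp: S1_def is_semigroup_def)+
  have F: "F (mul1 S x (Some u)) y \<longleftrightarrow> F x (mul1 S (Some u) y)" if "u \<in> U" for x y u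
    using that U bal S1r S1l unfolding F_def by blast
  have "\<beta> u = \<gamma> u" if "u \<in> U" for u
  proof
    fix p
    have "\<beta> u (P p) = P (\<beta> u p)" using F[OF that] by (simp add: \<beta>_def P_def)
    then show "\<beta> u p = \<gamma> u p" by (simp add: \<gamma>_def PP)
  qed
  then have "\<beta> d = \<gamma> d" by (rule dominion_all_types[OF d U T \<beta> \<gamma>])
  \<comment> \<open>At this point the inner \<open>P\<close> of \<open>\<gamma>\<close> cancels. The
    first components become \<open>F (Some d)\<close> and \<open>F None\<close> shifted by
    \<open>d\<close>; their values at \<open>None\<close> are the two sides of the claim.\<close>
  from fun_cong[OF this, of "P (\<lambda>_. False, None)"]
  have "P (\<beta> d (\<lambda>_. False, None)) = \<beta> d (P (\<lambda>_. False, None))" by (simp add: \<gamma>_def PP)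
  then have "F (Some d) None \<longleftrightarrow> F None (Some d)"
    by (simp add: \<beta>_def P_def fun_eq_iff)
  moreover have "d \<in> carrier S" using d by (simp add: dominion_def)
  ultimately show ?thesis by (simp add: F_def S1_def)
qed


subsection \<open>Ascending chains of principal ideals\<close>

lemma finite_semigroup_has_idempotent:
  assumes assoc: "\<And>x y z. f (f x y) z = f x (f y z)"
    and A: "finite A" "A \<noteq> {}" "\<And>x y. x \<in> A \<Longrightarrow> y \<in> A \<Longrightarrow> f x y \<in> A"
  shows "\<exists>e\<in>A. f e e = e"
proof -
  let ?A = "\<lparr>carrier = A, mul = f\<rparr>"
  obtain s where "s \<in> A" using A(2) by blast
  moreover have "is_semigroup ?A" using assoc A(3) by (auto simp: is_semigroup_def)
  ultimately have "\<exists>!e. e \<in> idempotents ?A \<and> (\<exists>n\<ge>1. e = spow ?A s n)"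
    using A(1) by (intro ex1_idempotent_power) auto
  then show ?thesis by (auto simp: idempotents_def)
qed

text \<open>The monoid plays the role of \<open>S\<close> with an adjoined unit. The identity of
  \<open>V1\<close> enters only as \<open>group_element\<close> (\<open>i\<close> is the identity of
  a subgroup containing the product), the dominion only as \<open>balanced\<close>.\<close>

locale epi_embedded = monoid f z for f (infixl "\<odot>" 70) and z ("\<one>") +
  fixes U S :: "'a set"
  assumes U_sub: "U \<subseteq> S"
    and one_notin: "\<one> \<notin> S"
    and U_closed: "\<And>x y. x \<in> U \<Longrightarrow> y \<in> U \<Longrightarrow> x \<odot> y \<in> U"
    and S_closed: "\<And>x y. x \<in> S \<Longrightarrow> y \<in> S \<Longrightarrow> x \<odot> y \<in> S"
    and U_finite: "finite U"
    and group_element: "\<And>e x g. e \<in> U \<Longrightarrow> e \<odot> e = e \<Longrightarrow> g \<in> U \<Longrightarrow> g \<odot> g = g \<Longrightarrow> x \<in> U \<Longrightarrow>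
      \<exists>i\<in>U. i \<odot> i = i \<and> i \<odot> (e \<odot> x \<odot> g) = e \<odot> x \<odot> g \<and> (e \<odot> x \<odot> g) \<odot> i = e \<odot> x \<odot> g \<and>
        (\<exists>w\<in>U. i = (e \<odot> x \<odot> g) \<odot> w) \<and> (\<exists>w\<in>U. i = w \<odot> (e \<odot> x \<odot> g))"
    and balanced: "\<And>h d. (\<And>x y u. x \<in> insert \<one> S \<Longrightarrow> y \<in> insert \<one> S \<Longrightarrow> u \<in> U \<Longrightarrow>
        h (x \<odot> u) y \<longleftrightarrow> h x (u \<odot> y)) \<Longrightarrow> d \<in> S \<Longrightarrow> h d \<one> \<longleftrightarrow> h \<one> d"
begin

text \<open>All assumptions are left-right symmetric: reversal swaps the two one-sided clauses of
  \<open>group_element\<close> and the arguments of \<open>h\<close>. Later lemmas thus come with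
  mirror images.\<close>

lemma opposite: "epi_embedded (\<lambda>x y. y \<odot> x) \<one> U S"
proof
  fix e x g assume "e \<in> U" "e \<odot> e = e" "g \<in> U" "g \<odot> g = g" "x \<in> U"
  then show "\<exists>i\<in>U. i \<odot> i = i \<and> g \<odot> (x \<odot> e) \<odot> i = g \<odot> (x \<odot> e) \<and> i \<odot> (g \<odot> (x \<odot> e)) = g \<odot> (x \<odot> e) \<and>
        (\<exists>w\<in>U. i = w \<odot> (g \<odot> (x \<odot> e))) \<and> (\<exists>w\<in>U. i = g \<odot> (x \<odot> e) \<odot> w)"
    using group_element[of g e x] by (auto simp: assoc)
next
  fix h :: "'a \<Rightarrow> 'a \<Rightarrow> bool" and d
  assume h: "\<And>x y u. x \<in> insert \<one> S \<Longrightarrow> y \<in> insert \<one> S \<Longrightarrow> u \<in> U \<Longrightarrow> h (u \<odot> x) y \<longleftrightarrow> h x (y \<odot> u)"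
    and "d \<in> S"
  then show "h d \<one> \<longleftrightarrow> h \<one> d" using balanced[of "\<lambda>x y. h y x" d] by blast
qed (use U_sub one_notin U_closed S_closed U_finite assoc in auto)

text \<open>The predicate \<open>h\<close> holds at \<open>(\<one>, d)\<close> and fails at
  \<open>(d, \<one>)\<close>, so it is not balanced. Right multiplication by \<open>u\<close> cannot
  leave \<open>U\<close> with \<open>\<one>\<close> adjoined, so balance breaks where
  \<open>e \<odot> x\<close> is outside and \<open>e \<odot> x \<odot> u\<close> inside.\<close>

lemma escape:
  assumes d: "d \<in> S - U" and e: "e \<in> insert \<one> U" "e \<odot> d = d"
  shows "\<exists>x\<in>insert \<one> S. \<exists>u\<in>U. \<exists>y\<in>S - U.
    e \<odot> x \<in> S - U \<and> e \<odot> x \<odot> u \<in> U \<and> d = e \<odot> x \<odot> u \<odot> y"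
proof -
  define h where "h x y \<longleftrightarrow> e \<odot> x \<in> insert \<one> U \<and> x \<odot> y = d" for x y
  have "h \<one> d" "\<not> h d \<one>" using d e one_notin by (auto simp: h_def)
  then obtain x y u where xyu: "x \<in> insert \<one> S" "y \<in> insert \<one> S" "u \<in> U"
    and "h (x \<odot> u) y \<noteq> h x (u \<odot> y)"
    using balanced[of h d] d by blast
  moreover have "e \<odot> x \<in> insert \<one> U \<Longrightarrow> e \<odot> x \<odot> u \<in> U"
    using U_closed xyu(3) by (cases "e \<odot> x = \<one>") auto
  ultimately have exu: "e \<odot> x \<odot> u \<in> insert \<one> U" "e \<odot> x \<notin> insert \<one> U" "x \<odot> u \<odot> y = d"
    by (auto simp: h_def assoc)
  have ex: "e \<odot> x \<in> S - U" using exu(2) e(1) xyu(1) U_sub S_closed by auto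
  then have exuU: "e \<odot> x \<odot> u \<in> U" using exu(1) one_notin S_closed[of "e \<odot> x" u] U_sub xyu(3) by auto
  have "d = e \<odot> x \<odot> u \<odot> y" using exu(3) e(2) by (simp add: assoc)
  moreover from this have "y \<in> S - U" using xyu(2) d exuU U_closed by auto
  ultimately show ?thesis using xyu ex exuU by blast
qed

lemma factor:
  assumes "d \<in> S - U"
  shows "\<exists>a\<in>U. \<exists>y\<in>S - U. d = a \<odot> y"
  using escape[OF assms, of \<one>] by auto

text \<open>Take \<open>p\<close> with \<open>pU\<close> smallest and factor the remainder once
  more, giving \<open>q = p \<odot> a\<close>. Then \<open>qU = pU\<close> contains
  \<open>q\<close>, so the elements of \<open>U\<close> fixing \<open>q\<close> on the right form a
  nonempty finite semigroup, which has an idempotent.\<close>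

lemma factor_idempotent:
  assumes d: "d \<in> S - U"
  shows "\<exists>p\<in>U. \<exists>g\<in>U. \<exists>y\<in>S - U. g \<odot> g = g \<and> d = p \<odot> g \<odot> y"
proof -
  define Q where "Q p \<longleftrightarrow> p \<in> U \<and> (\<exists>y\<in>S - U. d = p \<odot> y)" for p
  have "\<exists>p. Q p" using factor[OF d] by (auto simp: Q_def)
  then obtain p where p: "Q p" and min: "\<And>q. Q q \<Longrightarrow> card ((\<odot>) p ` U) \<le> card ((\<odot>) q ` U)"
    using ex_has_least_nat[of Q _ "\<lambda>p. card ((\<odot>) p ` U)"] by blast
  obtain y where y: "p \<in> U" "y \<in> S - U" "d = p \<odot> y" using p by (auto simp: Q_def)
  obtain a y' where a: "a \<in> U" "y' \<in> S - U" "y = a \<odot> y'" using factor[OF y(2)] by blast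
  define q where "q = p \<odot> a"
  have q: "q \<in> U" "d = q \<odot> y'" using y a U_closed by (auto simp: q_def assoc)
  then have "Q q" using a by (auto simp: Q_def)
  moreover have "(\<odot>) q ` U \<subseteq> (\<odot>) p ` U" using a U_closed by (auto simp: q_def assoc)
  ultimately have "(\<odot>) q ` U = (\<odot>) p ` U" using min U_finite by (simp add: card_seteq)
  then have "q \<in> (\<odot>) q ` U" using a by (auto simp: q_def)
  then have "{t \<in> U. q \<odot> t = q} \<noteq> {}" by auto
  then have "\<exists>g\<in>{t \<in> U. q \<odot> t = q}. g \<odot> g = g"
    using U_finite U_closed by (intro finite_semigroup_has_idempotent) (auto simp flip: assoc)
  then show ?thesis using q a(2) by force
qed

text \<open>
  \<open>principal e\<close> is the ideal \<open>UeU\<close> rather than \<open>U\<^sup>1eU\<^sup>1\<close>; the two coincide for idempotent \<open>e\<close>.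
\<close>

definition principal :: "'a \<Rightarrow> 'a set" where
  "principal e = {p \<odot> e \<odot> q | p q. p \<in> U \<and> q \<in> U}"

definition left_minimal :: "'a \<Rightarrow> bool" where
  "left_minimal e \<longleftrightarrow> e \<in> U \<and> e \<odot> e = e \<and> (\<exists>d\<in>S - U. e \<odot> d = d \<and>
    (\<forall>g\<in>U. g \<odot> g = g \<and> g \<odot> d = d \<longrightarrow> card ((\<odot>) e ` U) \<le> card ((\<odot>) g ` U)))"

definition right_minimal :: "'a \<Rightarrow> bool" where
  "right_minimal e \<longleftrightarrow> e \<in> U \<and> e \<odot> e = e \<and> (\<exists>d\<in>S - U. d \<odot> e = d \<and>
    (\<forall>g\<in>U. g \<odot> g = g \<and> d \<odot> g = d \<longrightarrow> card ((\<lambda>t. t \<odot> e) ` U) \<le> card ((\<lambda>t. t \<odot> g) ` U)))"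

lemma principal_subset: "e \<in> U \<Longrightarrow> principal e \<subseteq> U"
  using U_closed by (auto simp: principal_def)

lemma ex_right_minimal:
  assumes "d \<in> S - U" "e \<in> U" "e \<odot> e = e" "d \<odot> e = d"
  shows "\<exists>k. right_minimal k \<and> d \<odot> k = d"
proof -
  define Q where "Q g \<longleftrightarrow> g \<in> U \<and> g \<odot> g = g \<and> d \<odot> g = d" for g
  have "Q e" using assms by (simp add: Q_def)
  then obtain k where "Q k" "\<And>g. Q g \<Longrightarrow> card ((\<lambda>t. t \<odot> k) ` U) \<le> card ((\<lambda>t. t \<odot> g) ` U)"
    using ex_has_least_nat[of Q _ "\<lambda>g. card ((\<lambda>t. t \<odot> g) ` U)"] by blast
  then show ?thesis using assms(1) by (auto simp: right_minimal_def Q_def)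
qed

section \<open>Left-right duality\<close>

interpretation op: epi_embedded "\<lambda>x y. y \<odot> x" \<one> U S
  by (rule opposite)

lemma op_principal: "op.principal = principal"
  unfolding op.principal_def[abs_def] principal_def[abs_def] by (auto simp: assoc fun_eq_iff)

lemma op_left_minimal: "op.left_minimal = right_minimal"
  unfolding op.left_minimal_def[abs_def] right_minimal_def[abs_def] ..

lemma op_right_minimal: "op.right_minimal = left_minimal"
  unfolding op.right_minimal_def[abs_def] left_minimal_def[abs_def] ..

lemma ascend_left:
  assumes "left_minimal e"
  shows "\<exists>k. right_minimal k \<and> card (principal e) < card (principal k)"
proof -
  obtain d where e: "e \<in> U" "e \<odot> e = e" and d: "d \<in> S - U" "e \<odot> d = d"
    and min: "\<And>g. g \<in> U \<Longrightarrow> g \<odot> g = g \<Longrightarrow> g \<odot> d = d \<Longrightarrow> card ((\<odot>) e ` U) \<le> card ((\<odot>) g ` U)"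
    using assms by (auto simp: left_minimal_def)
  obtain x0 u y where "x0 \<in> insert \<one> S" and u: "u \<in> U" and y: "y \<in> S - U"
    and ex0: "e \<odot> x0 \<in> S - U" "e \<odot> x0 \<odot> u \<in> U" "d = e \<odot> x0 \<odot> u \<odot> y"
    using escape[OF d(1) _ d(2)] e(1) by blast
  define x where "x = e \<odot> x0"
  have x: "x \<in> S - U" "x \<odot> u \<in> U" "d = x \<odot> u \<odot> y" "e \<odot> x = x"
    using ex0 e by (auto simp: x_def assoc) (metis assoc)
  obtain p g y' where p: "p \<in> U" "g \<in> U" "g \<odot> g = g" "y' \<in> S - U" "y = p \<odot> g \<odot> y'"
    using factor_idempotent[OF y] by blast
  \<comment> \<open>Lies between two idempotents, as \<open>group_element\<close> requires, and is
    still \<open>x\<close> times an element of \<open>U\<close>. Hence \<open>i\<close>, and by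
    minimality \<open>e\<close>, will lie in \<open>xU\<close>.\<close>
  define r where "r = e \<odot> (x \<odot> u \<odot> p) \<odot> g"
  have r_eq: "r = x \<odot> (u \<odot> p \<odot> g)" using x(4) by (simp add: r_def flip: assoc)
  obtain i w where i: "i \<in> U" "i \<odot> i = i" "i \<odot> r = r" "w \<in> U" "i = r \<odot> w"
    using group_element[OF e p(2,3), of "x \<odot> u \<odot> p"] x(2) p(1) U_closed unfolding r_def by blast
  have "d = r \<odot> y'" using x(3) p(5) by (simp add: r_eq assoc)
  then have "i \<odot> d = d" using i(3) by (simp flip: assoc)
  then have "card ((\<odot>) e ` U) \<le> card ((\<odot>) i ` U)" using min i by blast
  moreover have "(\<odot>) i ` U \<subseteq> (\<odot>) e ` U"
  proof
    fix t assume "t \<in> (\<odot>) i ` U"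
    then obtain s where s: "s \<in> U" "t = i \<odot> s" by blast
    have "e \<odot> i = i" using e(2) i(5) by (simp add: r_def flip: assoc)
    then have "t = e \<odot> (i \<odot> s)" using s(2) by (simp flip: assoc)
    then show "t \<in> (\<odot>) e ` U" using s(1) i(1) U_closed by blast
  qed
  ultimately have "(\<odot>) i ` U = (\<odot>) e ` U" using U_finite by (simp add: card_seteq)
  moreover have "e \<in> (\<odot>) e ` U" using e by (metis image_eqI)
  ultimately obtain q where q: "q \<in> U" "e = i \<odot> q" by blast
  define v where "v = u \<odot> p \<odot> g \<odot> w \<odot> q"
  have v: "v \<in> U" "e = x \<odot> v"
    using q i p u U_closed by (simp_all add: v_def r_eq assoc)
  obtain q2 h x2 where x2: "q2 \<in> U" "h \<in> U" "h \<odot> h = h" "x2 \<in> S - U" "x = x2 \<odot> (h \<odot> q2)"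
    using op.factor_idempotent[OF x(1)] by blast
  \<comment> \<open>Replaces \<open>x\<close> by a left factor outside \<open>U\<close> that an
    idempotent fixes on the right.\<close>
  define X where "X = e \<odot> x2 \<odot> h"
  have Xx: "x = X \<odot> q2" using x2(5) x(4) by (simp add: X_def assoc)
  have X: "X \<in> S - U"
  proof
    show "X \<in> S" unfolding X_def using e(1) x2(2,4) S_closed U_sub by blast
    show "X \<notin> U" using Xx x(1) x2(1) U_closed by blast
  qed
  have "X \<odot> h = X" using x2(3) by (simp add: X_def assoc)
  then obtain k where "right_minimal k" and Xk: "X \<odot> k = X"
    using ex_right_minimal[OF X x2(2,3)] by blast
  then have k: "k \<in> U" "k \<odot> k = k" by (auto simp: right_minimal_def)
  \<comment> \<open>Chosen to carry \<open>X\<close> back to \<open>e\<close>, again between two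
    idempotents. Its subgroup identity \<open>j\<close> gives
    \<open>e \<odot> w' \<odot> a = e\<close>, which places \<open>e\<close> in the ideal of
    \<open>k\<close>.\<close>
  define a where "a = k \<odot> (q2 \<odot> v) \<odot> e"
  have aU: "a \<in> U" using k(1) x2(1) v(1) e(1) U_closed by (simp add: a_def)
  have ka: "k \<odot> a = a" using k(2) by (simp add: a_def flip: assoc)
  have Xa: "X \<odot> a = e"
  proof -
    have "X \<odot> a = (X \<odot> k) \<odot> q2 \<odot> v \<odot> e" by (simp add: a_def assoc)
    also have "\<dots> = e" using Xk Xx v(2) e(2) by simp
    finally show ?thesis .
  qed
  obtain j w' where j: "a \<odot> j = a" "w' \<in> U" "j = w' \<odot> a"
    using group_element[OF k e, of "q2 \<odot> v"] x2(1) v(1) U_closed unfolding a_def by blast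
  have "X \<odot> (a \<odot> j) = e \<odot> w' \<odot> a" using Xa j(3) by (simp flip: assoc)
  then have ewa: "e \<odot> w' \<odot> a = e" using j(1) Xa by simp
  have "principal e \<subseteq> principal k"
  proof
    fix t assume "t \<in> principal e"
    then obtain p q where pq: "p \<in> U" "q \<in> U" "t = p \<odot> e \<odot> q" by (auto simp: principal_def)
    have "t = p \<odot> (e \<odot> w' \<odot> (k \<odot> a)) \<odot> q" using pq(3) ewa ka by simp
    then have "t = (p \<odot> e \<odot> w') \<odot> k \<odot> (a \<odot> q)" by (simp add: assoc)
    then show "t \<in> principal k" unfolding principal_def using pq e(1) j(2) aU U_closed by blast
  qed
  moreover have "principal e \<noteq> principal k"
  proof
    assume "principal e = principal k"
    moreover have "k \<in> principal k" unfolding principal_def using k by force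
    ultimately have "k \<in> principal e" by simp
    then obtain p q where pq: "p \<in> U" "q \<in> U" "k = p \<odot> e \<odot> q" by (auto simp: principal_def)
    \<comment> \<open>With \<open>e\<close> rewritten through \<open>a\<close>, the set
      \<open>kU\<close> is a left translate of a subset of \<open>aU\<close>. As \<open>aU\<close>
      lies in \<open>kU\<close>, counting makes them equal, and \<open>k\<close> in
      \<open>aU\<close> would put \<open>X\<close> into \<open>eU\<close>.\<close>
    have "(p \<odot> e \<odot> w') \<odot> (a \<odot> q) = p \<odot> (e \<odot> w' \<odot> a) \<odot> q" by (simp only: assoc)
    then have kt: "(p \<odot> e \<odot> w') \<odot> (a \<odot> q) = k" by (simp only: ewa pq(3))
    have "(\<odot>) k ` U \<subseteq> (\<odot>) (p \<odot> e \<odot> w') ` ((\<odot>) a ` U)"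
    proof
      fix t assume "t \<in> (\<odot>) k ` U"
      then obtain s where "s \<in> U" "t = k \<odot> s" by blast
      then have "t = (p \<odot> e \<odot> w') \<odot> (a \<odot> (q \<odot> s))"
        by (simp only: assoc flip: kt)
      then show "t \<in> (\<odot>) (p \<odot> e \<odot> w') ` ((\<odot>) a ` U)" using \<open>s \<in> U\<close> pq(2) U_closed by blast
    qed
    then have "card ((\<odot>) k ` U) \<le> card ((\<odot>) a ` U)"
      using U_finite by (meson card_image_le card_mono finite_imageI le_trans)
    moreover have "(\<odot>) a ` U \<subseteq> (\<odot>) k ` U"
    proof
      fix t assume "t \<in> (\<odot>) a ` U"
      then obtain s where "s \<in> U" "t = a \<odot> s" by blast
      moreover from this have "t = k \<odot> (a \<odot> s)" using ka by (simp flip: assoc)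
      ultimately have "s \<in> U" "t = k \<odot> (a \<odot> s)" by blast+
      then show "t \<in> (\<odot>) k ` U" using aU U_closed by blast
    qed
    ultimately have "(\<odot>) a ` U = (\<odot>) k ` U" using U_finite by (simp add: card_seteq)
    moreover have "k \<in> (\<odot>) k ` U" using k by (metis image_eqI)
    ultimately obtain s where s: "s \<in> U" "k = a \<odot> s" by blast
    have "X = X \<odot> (a \<odot> s)" using Xk s(2) by simp
    also have "\<dots> = e \<odot> s" using Xa by (simp flip: assoc)
    finally show False using X e(1) s(1) U_closed by simp
  qed
  ultimately have "principal e \<subset> principal k" by blast
  then have "card (principal e) < card (principal k)"
    using principal_subset[OF k(1)] U_finite by (meson finite_subset psubset_card_mono)
  then show ?thesis using \<open>right_minimal k\<close> by blast
qed

end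

section \<open>Alternating the left and right ascents\<close>

context epi_embedded
begin

interpretation op: epi_embedded "\<lambda>x y. y \<odot> x" \<one> U S
  by (rule opposite)

lemma ascend_right:
  assumes "right_minimal e"
  shows "\<exists>k. left_minimal k \<and> card (principal e) < card (principal k)"
  using op.ascend_left[of e] assms
  by (simp add: op_principal op_left_minimal op_right_minimal)

lemma U_eq_S: "U = S"
proof (rule ccontr)
  assume "U \<noteq> S"
  then obtain d where d: "d \<in> S - U" using U_sub by blast
  obtain p g y where pg: "p \<in> U" "g \<in> U" "y \<in> S - U" "g \<odot> g = g" "d = y \<odot> (g \<odot> p)"
    using op.factor_idempotent[OF d] by blast
  \<comment> \<open>If \<open>y \<odot> g\<close> were in \<open>U\<close>, so would be
    \<open>d = y \<odot> g \<odot> p\<close>.\<close>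
  have "y \<odot> g \<in> S - U" using pg d S_closed U_sub U_closed
    by (metis DiffD1 DiffD2 DiffI assoc subsetD)
  moreover have "y \<odot> g \<odot> g = y \<odot> g" using pg(4) by (simp add: assoc)
  ultimately obtain k where k: "right_minimal k" using ex_right_minimal pg by blast
  \<comment> \<open>Each ascent ends at an idempotent to which the other one applies, so sizes grow
    without bound although every such ideal lies in \<open>U\<close>.\<close>
  have "\<exists>k. (left_minimal k \<or> right_minimal k) \<and> n \<le> card (principal k)" for n
  proof (induction n)
    case (Suc n)
    then show ?case using ascend_left ascend_right by (meson Suc_leI le_less_trans)
  qed (use k in blast)
  then obtain k where k: "left_minimal k \<or> right_minimal k" "Suc (card U) \<le> card (principal k)"
    by blast
  then have "k \<in> U" by (auto simp: left_minimal_def right_minimal_def)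
  then show False
    using k(2) card_mono[OF U_finite principal_subset] by fastforce
qed

end


subsection \<open>The pseudovariety\<close>

lemma omega_props:
  assumes "is_semigroup S" "finite (carrier S)" "s \<in> carrier S"
  shows "omega S s \<in> idempotents S" "\<exists>n\<ge>1. omega S s = spow S s n"
  using theI'[OF ex1_idempotent_power[OF assms(1,3,2)]] by (auto simp: omega_def)

text \<open>The identity says that \<open>r\<close> is fixed by its own idempotent power
  \<open>i\<close>, so the powers of \<open>r\<close> form a cyclic group with identity
  \<open>i\<close>.\<close>

lemma V1_group_element:
  assumes S: "S \<in> V1" and e: "e \<in> idempotents S" and g: "g \<in> idempotents S" and x: "x \<in> carrier S"
    and r: "r = e \<cdot>\<^bsub>S\<^esub> x \<cdot>\<^bsub>S\<^esub> g"
  shows "\<exists>i\<in>carrier S. i \<cdot>\<^bsub>S\<^esub> i = i \<and> i \<cdot>\<^bsub>S\<^esub> r = r \<and> r \<cdot>\<^bsub>S\<^esub> i = r \<and>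
    (\<exists>w\<in>carrier S. i = r \<cdot>\<^bsub>S\<^esub> w) \<and> (\<exists>w\<in>carrier S. i = w \<cdot>\<^bsub>S\<^esub> r)"
proof -
  have sg: "is_semigroup S" and fin: "finite (carrier S)" using S by (auto simp: V1_def)
  have rS: "r \<in> carrier S" using e g x sg by (auto simp: r is_semigroup_def idempotents_def)
  define i where "i = omega S r"
  obtain n where n: "n \<ge> 1" "i = spow S r n"
    using omega_props[OF sg fin rS] by (auto simp: i_def)
  have i: "i \<in> carrier S" "i \<cdot>\<^bsub>S\<^esub> i = i"
    using omega_props[OF sg fin rS] by (auto simp: i_def idempotents_def)
  have ir: "i \<cdot>\<^bsub>S\<^esub> r = r" using S e g x by (auto simp: V1_def omega_plus_one_def i_def r)
  have "r \<cdot>\<^bsub>S\<^esub> i = spow S r (1 + n)"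
    using spow_add[OF sg rS, of 1 n] n by (simp add: spow_1)
  also have "\<dots> = r" using n ir by (simp add: spow_Suc)
  finally have ri: "r \<cdot>\<^bsub>S\<^esub> i = r" .
  \<comment> \<open>The doubled exponent is at least 2, so a factor \<open>r\<close> can be split
    off at either end with a positive exponent left over, even for \<open>n = 1\<close>.\<close>
  have i2: "i = spow S r (n + n)" using spow_add[OF sg rS n(1) n(1)] n(2) i(2) by simp
  have "spow S r (n + n) = r \<cdot>\<^bsub>S\<^esub> spow S r (n + n - 1)"
    using spow_add[OF sg rS, of 1 "n + n - 1"] n(1) by (simp add: spow_1)
  moreover have "spow S r (n + n) = spow S r (n + n - 1) \<cdot>\<^bsub>S\<^esub> r"
    using spow_add[OF sg rS, of "n + n - 1" 1] n(1) by (simp add: spow_1)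
  ultimately show ?thesis using i ir ri i2 spow_closed[OF sg rS] by metis
qed

text \<open>Homomorphisms commute with \<open>omega\<close>, and idempotents of the image lift to
  idempotents of \<open>S\<close>, so the identity is inherited.\<close>

lemma V1_image:
  assumes S: "S \<in> V1" and T: "is_semigroup T" and h: "h \<in> sg_hom S T"
  shows "T\<lparr>carrier := h ` carrier S\<rparr> \<in> V1"
proof -
  let ?W = "T\<lparr>carrier := h ` carrier S\<rparr>"
  have sg: "is_semigroup S" and fin: "finite (carrier S)" using S by (auto simp: V1_def)
  have clS: "x \<cdot>\<^bsub>S\<^esub> y \<in> carrier S" if "x \<in> carrier S" "y \<in> carrier S" for x y
    using sg that by (simp add: is_semigroup_def)
  have hT: "h x \<in> carrier T" if "x \<in> carrier S" for x using h that by (simp add: sg_hom_def)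
  have hm: "h (x \<cdot>\<^bsub>S\<^esub> y) = h x \<cdot>\<^bsub>T\<^esub> h y" if "x \<in> carrier S" "y \<in> carrier S" for x y
    using h that by (simp add: sg_hom_def)
  have sgW: "is_semigroup ?W"
    unfolding is_semigroup_def
  proof (intro conjI ballI)
    fix a b assume "a \<in> carrier ?W" "b \<in> carrier ?W"
    then show "a \<cdot>\<^bsub>?W\<^esub> b \<in> carrier ?W" using clS by (auto simp flip: hm)
  next
    fix a b c assume "a \<in> carrier ?W" "b \<in> carrier ?W" "c \<in> carrier ?W"
    then show "(a \<cdot>\<^bsub>?W\<^esub> b) \<cdot>\<^bsub>?W\<^esub> c = a \<cdot>\<^bsub>?W\<^esub> (b \<cdot>\<^bsub>?W\<^esub> c)"
      using T hT by (auto simp: is_semigroup_def)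
  qed
  have finW: "finite (carrier ?W)" using fin by simp
  have pow: "h (spow S s n) = spow ?W (h s) n" if "s \<in> carrier S" for s n
  proof -
    have "((\<lambda>t. t \<cdot>\<^bsub>S\<^esub> s) ^^ k) s \<in> carrier S \<and>
      h (((\<lambda>t. t \<cdot>\<^bsub>S\<^esub> s) ^^ k) s) = ((\<lambda>t. t \<cdot>\<^bsub>T\<^esub> h s) ^^ k) (h s)" for k
      by (induction k) (use that clS hm in auto)
    then show ?thesis by (simp add: spow_def)
  qed
  have idem: "h e \<in> idempotents ?W" if "e \<in> idempotents S" for e
    using that by (auto simp: idempotents_def) (metis hm)
  have om: "omega ?W (h s) = h (omega S s)" if s: "s \<in> carrier S" for s
    unfolding omega_def[of ?W]
  proof (rule the1_equality)
    show "\<exists>!e. e \<in> idempotents ?W \<and> (\<exists>n\<ge>1. e = spow ?W (h s) n)"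
      using s by (intro ex1_idempotent_power[OF sgW _ finW]) auto
    show "h (omega S s) \<in> idempotents ?W \<and> (\<exists>n\<ge>1. h (omega S s) = spow ?W (h s) n)"
      using omega_props[OF sg fin s] idem pow[OF s] by metis
  qed
  \<comment> \<open>For any preimage \<open>s\<close> of \<open>e\<close>, the idempotent
    \<open>omega S s\<close> is mapped to \<open>omega ?W e\<close>, which is \<open>e\<close>
    itself.\<close>
  have lift: "\<exists>e0\<in>idempotents S. e = h e0" if e: "e \<in> idempotents ?W" for e
  proof -
    obtain s where s: "s \<in> carrier S" "e = h s" using e by (auto simp: idempotents_def)
    have "omega ?W e = e"
      unfolding omega_def
    proof (rule the1_equality)
      show "\<exists>!i. i \<in> idempotents ?W \<and> (\<exists>n\<ge>1. i = spow ?W e n)"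
        using e by (intro ex1_idempotent_power[OF sgW _ finW]) (auto simp: idempotents_def)
      show "e \<in> idempotents ?W \<and> (\<exists>n\<ge>1. e = spow ?W e n)"
        using e spow_1[of ?W e] by (metis One_nat_def order_refl)
    qed
    then show ?thesis using om s omega_props(1)[OF sg fin s(1)] by metis
  qed
  have "omega_plus_one ?W (e \<cdot>\<^bsub>?W\<^esub> x \<cdot>\<^bsub>?W\<^esub> f) = e \<cdot>\<^bsub>?W\<^esub> x \<cdot>\<^bsub>?W\<^esub> f"
    if x: "x \<in> carrier ?W" and e: "e \<in> idempotents ?W" and f: "f \<in> idempotents ?W" for x e f
  proof -
    obtain x0 where x0: "x0 \<in> carrier S" "x = h x0" using x by auto
    obtain e0 f0 where ef: "e0 \<in> idempotents S" "e = h e0" "f0 \<in> idempotents S" "f = h f0"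
      using lift e f by blast
    then have efS: "e0 \<in> carrier S" "f0 \<in> carrier S" by (auto simp: idempotents_def)
    define r where "r = e0 \<cdot>\<^bsub>S\<^esub> x0 \<cdot>\<^bsub>S\<^esub> f0"
    have rS: "r \<in> carrier S" using efS x0 clS by (simp add: r_def)
    have "omega S r \<cdot>\<^bsub>S\<^esub> r = r"
      using S x0 ef by (auto simp: V1_def omega_plus_one_def r_def)
    moreover have "omega S r \<in> carrier S"
      using omega_props(1)[OF sg fin rS] by (simp add: idempotents_def)
    ultimately have "omega_plus_one ?W (h r) = h r"
      using om[OF rS] hm rS by (simp add: omega_plus_one_def) metis
    moreover have "h r = e \<cdot>\<^bsub>?W\<^esub> x \<cdot>\<^bsub>?W\<^esub> f" using efS x0 ef clS by (simp add: r_def hm)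
    ultimately show ?thesis by simp
  qed
  then show ?thesis using sgW finW by (simp add: V1_def)
qed

text \<open>Instantiates the abstract argument in the option type, where \<open>None\<close> is a
  new unit even if \<open>S\<close> already has one.\<close>

lemma V1_dominion_eq:
  assumes S: "is_semigroup S" and A: "A \<subseteq> carrier S" and V: "S\<lparr>carrier := A\<rparr> \<in> V1"
    and dom: "dominion A S = carrier S"
  shows "A = carrier S"
proof -
  let ?W = "S\<lparr>carrier := A\<rparr>"
  have AA: "x \<cdot>\<^bsub>S\<^esub> y \<in> A" if "x \<in> A" "y \<in> A" for x y
    using V that by (auto simp: V1_def is_semigroup_def)
  have mul1_eq: "mul1 S (Some x) (Some y) = Some (x \<cdot>\<^bsub>S\<^esub> y)" if "x \<in> A" "y \<in> A" for x y
    using A that by auto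
  interpret M: monoid "mul1 S" None by (rule monoid_mul1[OF S])
  have "epi_embedded (mul1 S) None (Some ` A) (Some ` carrier S)"
  proof
    show "finite (Some ` A)" using V by (simp add: V1_def)
    show "Some ` A \<subseteq> Some ` carrier S" using A by blast
    show "None \<notin> Some ` carrier S" by blast
  next
    fix x y assume "x \<in> Some ` A" "y \<in> Some ` A"
    then show "mul1 S x y \<in> Some ` A"
      using AA by (auto simp: mul1_eq simp del: mul1.simps(3))
  next
    fix x y assume "x \<in> Some ` carrier S" "y \<in> Some ` carrier S"
    then show "mul1 S x y \<in> Some ` carrier S"
      using S by (auto simp: is_semigroup_def)
  next
    fix e x g
    assume e: "e \<in> Some ` A" "mul1 S e e = e" and g: "g \<in> Some ` A" "mul1 S g g = g"
      and x: "x \<in> Some ` A"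
    let ?r = "mul1 S (mul1 S e x) g"
    obtain e0 x0 g0 where 0: "e0 \<in> A" "x0 \<in> A" "g0 \<in> A" "e = Some e0" "x = Some x0" "g = Some g0"
      using e g x by blast
    define r where "r = e0 \<cdot>\<^bsub>S\<^esub> x0 \<cdot>\<^bsub>S\<^esub> g0"
    have rA: "r \<in> A" and r: "?r = Some r" using 0 AA by (simp_all add: r_def mul1_eq del: mul1.simps(3))
    have "e0 \<in> idempotents ?W" "g0 \<in> idempotents ?W" "x0 \<in> carrier ?W"
      using 0 e g by (auto simp: idempotents_def mul1_eq simp del: mul1.simps(3))
    then have "\<exists>i\<in>A. i \<cdot>\<^bsub>S\<^esub> i = i \<and> i \<cdot>\<^bsub>S\<^esub> r = r \<and> r \<cdot>\<^bsub>S\<^esub> i = r \<and>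
        (\<exists>w\<in>A. i = r \<cdot>\<^bsub>S\<^esub> w) \<and> (\<exists>w\<in>A. i = w \<cdot>\<^bsub>S\<^esub> r)"
      using V1_group_element[OF V, of e0 g0 x0 r] by (simp add: r_def)
    then obtain i w w' where i: "i \<in> A" "w \<in> A" "w' \<in> A" "i \<cdot>\<^bsub>S\<^esub> i = i" "i \<cdot>\<^bsub>S\<^esub> r = r"
      "r \<cdot>\<^bsub>S\<^esub> i = r" "i = r \<cdot>\<^bsub>S\<^esub> w" "i = w' \<cdot>\<^bsub>S\<^esub> r"
      by blast
    show "\<exists>i\<in>Some ` A. mul1 S i i = i \<and> mul1 S i ?r = ?r \<and> mul1 S ?r i = ?r \<and>
      (\<exists>w\<in>Some ` A. i = mul1 S ?r w) \<and> (\<exists>w\<in>Some ` A. i = mul1 S w ?r)"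
      unfolding r
    proof (rule bexI[of _ "Some i"], intro conjI)
      show "\<exists>w\<in>Some ` A. Some i = mul1 S (Some r) w" unfolding i(7) mul1_eq[OF rA i(2), symmetric] using i(2) by blast
      show "\<exists>w\<in>Some ` A. Some i = mul1 S w (Some r)" unfolding i(8) mul1_eq[OF i(3) rA, symmetric] using i(3) by blast
    qed (simp_all add: mul1_eq i(1,4,5,6) rA del: mul1.simps(3))
  next
    fix h d
    assume h: "\<And>x y u. x \<in> insert None (Some ` carrier S) \<Longrightarrow> y \<in> insert None (Some ` carrier S) \<Longrightarrow>
        u \<in> Some ` A \<Longrightarrow> h (mul1 S x u) y \<longleftrightarrow> h x (mul1 S u y)"
      and "d \<in> Some ` carrier S"
    then obtain d0 where d: "d = Some d0" "d0 \<in> dominion A S" using dom by blast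
    show "h d None \<longleftrightarrow> h None d"
      unfolding d(1) by (rule dominion_balanced[OF S A d(2)]) (rule h, auto)
  qed
  then have "Some ` A = Some ` carrier S" by (rule epi_embedded.U_eq_S)
  then show ?thesis by (simp add: inj_image_eq_iff)
qed

theorem theorem4p1:
  shows "saturated_class TYPE('b) (V1 :: 'a magma set) \<and>
    epimorphically_closed (V1 :: 'a magma set) (V1 :: 'b magma set)"
proof
  \<comment> \<open>Serves both claims: a proper embedding cannot have full dominion, and an
    epimorphism from a member of \<open>V1\<close> is onto.\<close>
  have im: "h ` carrier S = carrier T"
    if "S \<in> V1" "is_semigroup T" "h \<in> sg_hom S T" "dominion (h ` carrier S) T = carrier T"
    for S :: "'a magma" and T :: "'b magma" and h
    using V1_dominion_eq[OF that(2) _ V1_image[OF that(1-3)] that(4)] that(3)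
    by (auto simp: sg_hom_def)
  show "saturated_class TYPE('b) (V1 :: 'a magma set)"
    unfolding saturated_class_def saturated_def using im by blast
  show "epimorphically_closed (V1 :: 'a magma set) (V1 :: 'b magma set)"
    unfolding epimorphically_closed_def
  proof (intro ballI allI impI)
    fix S :: "'a magma" and T :: "'b magma" and \<alpha>
    assume S: "S \<in> V1" and "is_semigroup T \<and> epimorphism S T \<alpha>"
    then have T: "is_semigroup T" "\<alpha> \<in> sg_hom S T" "dominion (\<alpha> ` carrier S) T = carrier T"
      by (auto simp: epimorphism_iff_dominion)
    show "T \<in> V1" using V1_image[OF S T(1,2)] im[OF S T] by simp
  qed
qed

end
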